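(* Fix a precision $(p.q)$ with $p\ge p'$, $q\ge q'$, and a step size $\rho\in\mathbb{R}_{(p.q)}$ with $0<\rho\le L^{-1}$. Let $\Omega>0$ satisfy $\|\rho\nabla f(\hat x)-\hat g_\rho(\hat x)\|\le\Omega$ for all $\hat x\in\mathcal{X}_{(p.q)}$ and all problems in the family $\mathbb{P}$. Let $\{\hat x^k\}$ be the sequence generated by the fixed-point proximal gradient method applied to a problem of the family $\mathbb{P}$, with starting point $\hat x^0\in\hat{\mathcal{X}}^0_{(p.q)}$, and let $x^*$ be the optimal solution and $f^*$ the optimal value of that problem. Choose $\epsilon>0$ with $\epsilon\rho\sigma>4\Omega$. Then, as long as $\|\hat x^{k+1}-x^*\|\ge \epsilon/2$ holds along the iterations, i.e., for every $k$ such that $\|\hat x^{j+1}-x^*\|\ge\epsilon/2$ for all integers $0\le j<k$, the following hold: (i) $\displaystyle \|\hat x^k-x^*\|^2\le\left(\frac{1-\rho\sigma}{1-4\Omega\epsilon^{-1}}\right)^{k}\|\hat x^0-x^*\|^2$, for $k\ge 0$; (ii) $\displaystyle f(\hat x^k)-f^*\le\frac{1-4\Omega\epsilon^{-1}}{2\rho}\left(\frac{1-\rho\sigma}{1-4\Omega\epsilon^{-1}}\right)^{k}\|\hat x^0-x^*\|^2$, for $k\ge 1$.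
   Context: Fixed-point sets. $\mathbb{R}^n_{(p.q)}\subset\mathbb{R}^n$ is the set of vectors each of whose components has integer and fractional parts representable with $p$ and $q$ binary digits respectively (plus a sign), i.e. components of the form $m2^{-q}$ with $m\in\mathbb{Z}$, $|m|<2^{p+q}$; similarly for matrices. For $\mathcal{C}\subseteq\mathbb{R}^n$, $\mathcal{C}_{(p.q)}=\mathcal{C}\cap\mathbb{R}^n_{(p.q)}$. $\|\cdot\|$ is the Euclidean norm. Problem family. $\mathbb{P}$ is the family of strongly convex box-constrained QPs $\min_{x\in\mathbb{R}^n} f(x)=\frac12x^\top Qx+c^\top x$ subject to $\ell\le x\le u$ (componentwise), with $Q$ symmetric positive definite in a compact set $\mathbb{Q}\subset\mathbb{R}^{n\times n}_{(p'.q')}$, and $c,\ell,u\in\mathbb{R}^n_{(p'.q')}$ satisfying $c_{\min}\le c\le c_{\max}$, $\ell_{\min}\le\ell\le\ell_{\max}$, $u_{\min}\le u\le u_{\max}$ for fixed bounds in $\mathbb{R}^n_{(p'.q')}$, and $\ell\le u$. For a given problem, $\mathcal{X}=\{x\in\mathbb{R}^n:\ell\le x\le u\}$, $x^*$ is its unique minimizer and $f^*=f(x^* )$. $L,\sigma>0$ are constants valid for every problem in $\mathbb{P}$ such that for all $x,y\in\mathbb{R}^n$: $f(x)\le f(y)+\langle\nabla f(y),x-y\rangle+\frac L2\|x-y\|^2$ and $f(x)\ge f(y)+\langle\nabla f(y),x-y\rangle+\frac\sigma2\|x-y\|^2$. Fixed-point proximal gradient method. Given $\hat x^0\in\hat{\mathcal{X}}^0_{(p.q)}\subseteq\mathcal{X}_{(p.q)}$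 (set of possible initial points), iterate for $k=0,1,2,\dots$ $$\hat x^{k+1}=\min\{u,\max\{\ell,\hat x^k-\hat g_\rho(\hat x^k)\}\}$$ (min and max componentwise), where $\hat g_\rho:\mathcal{X}_{(p.q)}\to\mathbb{R}^n_{(p.q)}$ (depending on the problem) returns the result of evaluating $\rho\nabla f(\cdot)$ in fixed-point arithmetic; it may be treated as an arbitrary such map subject to the stated error bound. It is assumed throughout that no overflow occurs, so that the subtraction, min and max are exact and $\hat x^k\in\mathcal{X}_{(p.q)}$ for all $k$. The algorithm also has a stopping rule; statements about $\hat x^k$ concern the iterates given by this recursion. *)

theory Defs
  imports "HOL-Analysis.Analysis"
begin

definition fixed_nums :: "nat \<Rightarrow> nat \<Rightarrow> real set" where
  "fixed_nums p q = {of_int m / 2 ^ q | m :: int. \<bar>m\<bar> < 2 ^ (p + q)}"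

definition fixed_vecs :: "nat \<Rightarrow> nat \<Rightarrow> (real ^ 'n) set" where
  "fixed_vecs p q = {x. \<forall>i. x $ i \<in> fixed_nums p q}"

definition fixed_mats :: "nat \<Rightarrow> nat \<Rightarrow> (real ^ 'n ^ 'm) set" where
  "fixed_mats p q = {A. \<forall>i j. A $ i $ j \<in> fixed_nums p q}"

definition pos_def :: "real ^ 'n ^ 'n \<Rightarrow> bool" where
  "pos_def A \<longleftrightarrow> transpose A = A \<and> (\<forall>x. x \<noteq> 0 \<longrightarrow> 0 < x \<bullet> (A *v x))"

text \<open>Only meaningful where \<open>f\<close> is differentiable.\<close>

definition gradient :: "('a :: real_inner \<Rightarrow> real) \<Rightarrow> 'a \<Rightarrow> 'a" where
  "gradient f x = (THE D. GDERIV f x :> D)"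

record 'n qp =
  hess :: "real ^ 'n ^ 'n"
  lin :: "real ^ 'n"
  lower :: "real ^ 'n"
  upper :: "real ^ 'n"

definition qp_obj :: "'n :: finite qp \<Rightarrow> real ^ 'n \<Rightarrow> real" where
  "qp_obj P x = 1 / 2 * (x \<bullet> (hess P *v x)) + lin P \<bullet> x"

text \<open>The order on \<open>real ^ 'n\<close> is componentwise, so this interval is a box.\<close>

definition qp_feasible :: "'n :: finite qp \<Rightarrow> (real ^ 'n) set" where
  "qp_feasible P = {lower P..upper P}"

text \<open>The minimizer exists and is unique when the Hessian is positive definite and the box
  is nonempty, which holds for all members of the family below.\<close>

definition qp_sol :: "'n :: finite qp \<Rightarrow> real ^ 'n" where
  "qp_sol P = (THE x. is_arg_min (qp_obj P) (\<lambda>y. y \<in> qp_feasible P) x)"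

definition qp_val :: "'n :: finite qp \<Rightarrow> real" where
  "qp_val P = qp_obj P (qp_sol P)"

definition qp_family ::
  "nat \<Rightarrow> nat \<Rightarrow> (real ^ 'n ^ 'n) set \<Rightarrow> real ^ 'n \<Rightarrow> real ^ 'n \<Rightarrow> real ^ 'n \<Rightarrow> real ^ 'n \<Rightarrow>
    real ^ 'n \<Rightarrow> real ^ 'n \<Rightarrow> ('n :: finite) qp set" where
  "qp_family p q \<Q> c_min c_max l_min l_max u_min u_max =
    {P. hess P \<in> \<Q> \<and> pos_def (hess P) \<and>
        lin P \<in> fixed_vecs p q \<and> lower P \<in> fixed_vecs p q \<and> upper P \<in> fixed_vecs p q \<and>
        c_min \<le> lin P \<and> lin P \<le> c_max \<and>
        l_min \<le> lower P \<and> lower P \<le> l_max \<and>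
        u_min \<le> upper P \<and> upper P \<le> u_max \<and>
        lower P \<le> upper P}"

text \<open>Proximal gradient iteration from \<open>x0\<close>, where \<open>g\<close> returns the computed value of the
  gradient already multiplied by the step size. Subtraction, min and max are exact, which
  models fixed-point arithmetic as long as no overflow occurs.\<close>

primrec prox_grad :: "'n :: finite qp \<Rightarrow> (real ^ 'n \<Rightarrow> real ^ 'n) \<Rightarrow> real ^ 'n \<Rightarrow> nat \<Rightarrow> real ^ 'n"
  where
  "prox_grad P g x0 0 = x0"
| "prox_grad P g x0 (Suc k) =
    (\<chi> i. min (upper P $ i)
           (max (lower P $ i) ((prox_grad P g x0 k - g (prox_grad P g x0 k)) $ i)))"

lemma gradient_eqI:
  assumes "GDERIV f x :> D"
  shows "gradient f x = D"
  unfolding gradient_def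
proof (rule the_equality)
  show "GDERIV f x :> D" by (fact assms)
next
  fix D' assume "GDERIV f x :> D'"
  then have "(\<lambda>h. h \<bullet> D') = (\<lambda>h. h \<bullet> D)"
    using assms unfolding gderiv_def by (rule has_derivative_unique)
  then have "h \<bullet> D' = h \<bullet> D" for h by metis
  then show "D' = D" using vector_eq_ldot by blast
qed

lemma gradient_qp_obj:
  assumes "transpose (hess P) = hess P"
  shows "gradient (qp_obj P) x = hess P *v x + lin P"
proof (rule gradient_eqI)
  have sym: "x \<bullet> (hess P *v h) = h \<bullet> (hess P *v x)" for h
    by (metis assms dot_lmul_matrix inner_commute vector_transpose_matrix)
  have "(qp_obj P has_derivative
      (\<lambda>h. 1 / 2 * (x \<bullet> (hess P *v h) + h \<bullet> (hess P *v x)) + lin P \<bullet> h)) (at x)"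
    unfolding qp_obj_def
    by (auto intro!: derivative_eq_intros bounded_linear_imp_has_derivative)
  moreover have "(\<lambda>h. 1 / 2 * (x \<bullet> (hess P *v h) + h \<bullet> (hess P *v x)) + lin P \<bullet> h) =
      (\<lambda>h. h \<bullet> (hess P *v x + lin P))"
    by (simp add: fun_eq_iff sym inner_add_right inner_commute)
  ultimately show "GDERIV (qp_obj P) x :> hess P *v x + lin P"
    by (simp add: gderiv_def)
qed

end

theory Submission
  imports Defs
begin

text \<open>With the clamping step written as the projection of \<open>x - g\<close> onto the box, the usual
  three-point argument gives, for \<open>d = \<parallel>x - x*\<parallel>\<close> and \<open>d' = \<parallel>x' - x*\<parallel>\<close> at successive iterates,
  \<open>2 \<rho> (f x' - f*) + d'\<^sup>2 \<le> (1 - \<rho> \<sigma>) d\<^sup>2 + 2 \<Omega> d'\<close>. While \<open>d' \<ge> \<epsilon> / 2\<close>, the error term is at most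
  \<open>(4 \<Omega> / \<epsilon>) d'\<^sup>2\<close> and can be absorbed on the left. Dropping \<open>f x' - f* \<ge> 0\<close> gives the
  contraction of distances; dropping \<open>d'\<^sup>2\<close> instead gives the bound on values.\<close>

text \<open>The variational inequality of the projection onto a box, one coordinate at a time: if
  \<open>z $ i\<close> lies in its interval, the first factor vanishes; otherwise the clamp is the
  nearest endpoint and the two factors have opposite signs.\<close>

lemma clamp_inner_le_0:
  fixes l u z y :: "real ^ 'n"
  assumes "y \<in> {l..u}"
  shows "(z - (\<chi> i. min (u $ i) (max (l $ i) (z $ i)))) \<bullet>
    (y - (\<chi> i. min (u $ i) (max (l $ i) (z $ i)))) \<le> 0"
proof -
  have "(z $ i - min (u $ i) (max (l $ i) (z $ i))) *
      (y $ i - min (u $ i) (max (l $ i) (z $ i))) \<le> 0" for i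
  proof -
    have "l $ i \<le> y $ i" "y $ i \<le> u $ i" using assms by (auto simp: less_eq_vec_def)
    then show ?thesis by (auto simp: min_def max_def mult_le_0_iff)
  qed
  then show ?thesis by (simp add: inner_vec_def sum_nonpos)
qed

lemma clamp_in_box:
  fixes l u z :: "real ^ 'n"
  assumes "l \<le> u"
  shows "(\<chi> i. min (u $ i) (max (l $ i) (z $ i))) \<in> {l..u}"
  using assms by (auto simp: less_eq_vec_def)

lemma fixed_nums_mono:
  assumes "p' \<le> p" and "q' \<le> q"
  shows "fixed_nums p' q' \<subseteq> fixed_nums p q"
proof
  fix x assume "x \<in> fixed_nums p' q'"
  then obtain m :: int where x: "x = of_int m / 2 ^ q'" and m: "\<bar>m\<bar> < 2 ^ (p' + q')"
    by (auto simp: fixed_nums_def)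
  obtain d where q: "q = q' + d" using assms(2) le_Suc_ex by blast
  \<comment> \<open>Passing to \<open>q\<close> fractional digits multiplies the numerator by
    \<open>2 ^ d\<close>, and the bound on it grows by the same factor.\<close>
  have "\<bar>m * 2 ^ d\<bar> < 2 ^ (p' + q') * 2 ^ d" using m by (simp add: abs_mult)
  also have "\<dots> = 2 ^ (p' + q)" by (simp add: q power_add)
  also have "\<dots> \<le> 2 ^ (p + q)" using assms(1) by simp
  finally have "\<bar>m * 2 ^ d\<bar> < 2 ^ (p + q)" .
  moreover have "x = of_int (m * 2 ^ d) / 2 ^ q" by (simp add: x q power_add)
  ultimately show "x \<in> fixed_nums p q" unfolding fixed_nums_def by blast
qed

lemma fixed_vecs_mono:
  "p' \<le> p \<Longrightarrow> q' \<le> q \<Longrightarrow> fixed_vecs p' q' \<subseteq> fixed_vecs p q"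
  using fixed_nums_mono unfolding fixed_vecs_def by blast

text \<open>Each component of the clamp is a component of \<open>l\<close>, \<open>u\<close> or
  \<open>z\<close>, so clamping causes no rounding.\<close>

lemma clamp_in_fixed_vecs:
  assumes "l \<in> fixed_vecs p q" and "u \<in> fixed_vecs p q" and "z \<in> fixed_vecs p q"
  shows "(\<chi> i. min (u $ i) (max (l $ i) (z $ i))) \<in> fixed_vecs p q"
  using assms by (auto simp: fixed_vecs_def min_def max_def)

text \<open>The midpoint of two distinct minimizers would have a strictly smaller value than
  both.\<close>

lemma strongly_convex_minimizer_unique:
  fixes f :: "'a::real_inner \<Rightarrow> real"
  assumes sc: "\<And>x y. f x \<ge> f y + G y \<bullet> (x - y) + \<sigma> / 2 * (norm (x - y))\<^sup>2"
    and "0 < \<sigma>" and "convex S"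
    and x: "is_arg_min f (\<lambda>z. z \<in> S) x" and y: "is_arg_min f (\<lambda>z. z \<in> S) y"
  shows "x = y"
proof (rule ccontr)
  assume "x \<noteq> y"
  define m where "m = (1/2) *\<^sub>R x + (1/2) *\<^sub>R y"
  have "m \<in> S"
    using \<open>convex S\<close> x y unfolding m_def by (auto simp: is_arg_min_def intro!: convexD)
  then have fm: "f x \<le> f m" "f y \<le> f m"
    using x y by (force simp: is_arg_min_linorder)+
  have sub: "x - m = (1/2) *\<^sub>R (x - y)" "y - m = - ((1/2) *\<^sub>R (x - y))"
    by (auto simp: m_def algebra_simps simp flip: scaleR_left_distrib)
  \<comment> \<open>Strong convexity is expanded around \<open>m\<close>. The linear terms cancel in
    the sum because \<open>x - m\<close> and \<open>y - m\<close> are opposite.\<close>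
  have "f x + f y \<ge> 2 * f m + \<sigma> * (norm ((1/2) *\<^sub>R (x - y)))\<^sup>2"
    using sc[of m x] sc[of m y] unfolding sub norm_minus_cancel inner_minus_right by argo
  moreover have "0 < \<sigma> * (norm ((1/2) *\<^sub>R (x - y)))\<^sup>2" using \<open>x \<noteq> y\<close> \<open>0 < \<sigma>\<close> by simp
  ultimately show False using fm by linarith
qed

text \<open>Both quadratic bounds around one point share the same affine part, so comparing them at
  a second point leaves only the coefficients. This is what makes
  \<open>1 - \<rho> * \<sigma>\<close> nonnegative later.\<close>

lemma strong_convexity_le_smoothness:
  fixes f :: "real ^ 'n \<Rightarrow> real"
  assumes "\<And>x y. f x \<le> f y + G y \<bullet> (x - y) + L / 2 * (norm (x - y))\<^sup>2"
    and "\<And>x y. f x \<ge> f y + G y \<bullet> (x - y) + \<sigma> / 2 * (norm (x - y))\<^sup>2"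
  shows "\<sigma> \<le> L"
  \<comment> \<open>Both instances have \<open>x = 1\<close> and \<open>y = 0\<close>: since
    \<open>\<ge>\<close> abbreviates a reversed \<open>\<le>\<close>, \<open>y\<close> is the first
    variable of the second fact. The all-ones vector serves as a nonzero vector.\<close>
  using assms(1)[of "1" 0] assms(2)[of 0 "1"]
  by (smt (verit) divide_right_mono mult_right_le_imp_le norm_eq_zero zero_less_power2 one_neq_zero
      diff_zero field_sum_of_halves)

text \<open>Justifies the definite description in \<open>qp_sol\<close>: a minimizer exists by
  continuity on the compact box and is unique by strong convexity.\<close>

lemma qp_sol_is_arg_min:
  fixes P :: "'n::finite qp"
  assumes sc: "\<And>x y. qp_obj P x \<ge> qp_obj P y + G y \<bullet> (x - y) + \<sigma> / 2 * (norm (x - y))\<^sup>2"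
    and "0 < \<sigma>" and "lower P \<le> upper P"
  shows "is_arg_min (qp_obj P) (\<lambda>y. y \<in> qp_feasible P) (qp_sol P)"
proof -
  have box: "qp_feasible P = cbox (lower P) (upper P)"
    by (simp add: qp_feasible_def interval_cbox)
  have "continuous_on (qp_feasible P) (qp_obj P)"
    unfolding qp_obj_def by (intro continuous_intros matrix_vector_mult_linear_continuous_on)
  moreover have "compact (qp_feasible P)" by (simp add: box compact_cbox)
  moreover have "qp_feasible P \<noteq> {}" using assms(3) by (simp add: qp_feasible_def)
  ultimately obtain x where x: "is_arg_min (qp_obj P) (\<lambda>y. y \<in> qp_feasible P) x"
    using continuous_attains_inf by (metis is_arg_min_linorder)
  have "convex (qp_feasible P)" by (simp add: box convex_box)
  then show ?thesis
    unfolding qp_sol_def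
    using x strongly_convex_minimizer_unique[OF sc \<open>0 < \<sigma>\<close>] by (rule_tac theI) blast+
qed

lemma inexact_prox_grad_step:
  fixes x x' xs g :: "'a::real_inner"
  assumes smooth: "f x' \<le> f x + D \<bullet> (x' - x) + L / 2 * (norm (x' - x))\<^sup>2"
    and sc: "f xs \<ge> f x + D \<bullet> (xs - x) + \<sigma> / 2 * (norm (xs - x))\<^sup>2"
    and proj: "(x - g - x') \<bullet> (xs - x') \<le> 0"
    and err: "norm (\<rho> *\<^sub>R D - g) \<le> \<Omega>"
    and "0 < \<rho>" and "\<rho> * L \<le> 1"
  shows "2 * \<rho> * (f x' - f xs) + (norm (x' - xs))\<^sup>2
    \<le> (1 - \<rho> * \<sigma>) * (norm (x - xs))\<^sup>2 + 2 * \<Omega> * norm (x' - xs)"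
proof -
  define e where "e = \<rho> *\<^sub>R D - g"
  \<comment> \<open>Subtracting the two bounds around \<open>x\<close> eliminates \<open>f x\<close>
    and merges the linear terms into one along \<open>x' - xs\<close>.\<close>
  have "f x' - f xs \<le> D \<bullet> (x' - xs) + L / 2 * (norm (x' - x))\<^sup>2 - \<sigma> / 2 * (norm (x - xs))\<^sup>2"
    using smooth sc by (simp add: inner_diff_right norm_minus_commute)
  then have "2 * \<rho> * (f x' - f xs)
      \<le> 2 * \<rho> * (D \<bullet> (x' - xs) + L / 2 * (norm (x' - x))\<^sup>2 - \<sigma> / 2 * (norm (x - xs))\<^sup>2)"
    using \<open>0 < \<rho>\<close> by (intro mult_left_mono) auto
  also have "\<dots> = 2 * (\<rho> *\<^sub>R D \<bullet> (x' - xs)) + \<rho> * L * (norm (x' - x))\<^sup>2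
      - \<rho> * \<sigma> * (norm (x - xs))\<^sup>2"
    by (simp add: algebra_simps)
  finally have f: "2 * \<rho> * (f x' - f xs)
      \<le> 2 * (\<rho> *\<^sub>R D \<bullet> (x' - xs)) + \<rho> * L * (norm (x' - x))\<^sup>2 - \<rho> * \<sigma> * (norm (x - xs))\<^sup>2" .
  \<comment> \<open>The gradient term splits into the evaluation error, the step actually taken, and
    the projection residual, which is nonpositive by \<open>proj\<close>.\<close>
  have "\<rho> *\<^sub>R D \<bullet> (x' - xs) = e \<bullet> (x' - xs) + (x - x') \<bullet> (x' - xs) + (x - g - x') \<bullet> (xs - x')"
    by (simp add: e_def inner_diff_left inner_diff_right)
  \<comment> \<open>The three-point identity. Its term \<open>- (norm (x' - x))\<^sup>2\<close> pays
    for the smoothness term, since \<open>\<rho> * L \<le> 1\<close>.\<close>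
  moreover have "2 * ((x - x') \<bullet> (x' - xs))
      = (norm (x - xs))\<^sup>2 - (norm (x' - x))\<^sup>2 - (norm (x' - xs))\<^sup>2"
    by (simp add: power2_norm_eq_inner inner_diff_left inner_diff_right inner_commute)
  moreover have "e \<bullet> (x' - xs) \<le> \<Omega> * norm (x' - xs)"
    using norm_cauchy_schwarz[of e "x' - xs"] mult_right_mono[OF err, of "norm (x' - xs)"]
    by (simp add: e_def)
  moreover have "\<rho> * L * (norm (x' - x))\<^sup>2 \<le> (norm (x' - x))\<^sup>2"
    using mult_right_mono[OF \<open>\<rho> * L \<le> 1\<close>, of "(norm (x' - x))\<^sup>2"] by simp
  moreover have "(1 - \<rho> * \<sigma>) * (norm (x - xs))\<^sup>2 =
      (norm (x - xs))\<^sup>2 - \<rho> * \<sigma> * (norm (x - xs))\<^sup>2"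
    by (simp add: algebra_simps)
  ultimately show ?thesis using f proj by linarith
qed

text \<open>Here \<open>d\<close> stands for the distances to the solution and \<open>v\<close> for
  the optimality gaps; \<open>a\<close> is the factor from strong convexity and \<open>b\<close>
  what remains of \<open>d'\<^sup>2\<close> after the error is absorbed.\<close>

lemma recurrence_bounds:
  fixes d v :: "nat \<Rightarrow> real"
  assumes step: "\<And>j. j < k \<Longrightarrow> 2 * \<rho> * v (Suc j) + b * (d (Suc j))\<^sup>2 \<le> a * (d j)\<^sup>2"
    and v: "\<And>j. 0 \<le> v j" and "0 \<le> a" and "0 < b" and "0 < \<rho>"
  shows "(d k)\<^sup>2 \<le> (a / b) ^ k * (d 0)\<^sup>2"
    and "1 \<le> k \<Longrightarrow> v k \<le> b / (2 * \<rho>) * (a / b) ^ k * (d 0)\<^sup>2"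
proof -
  have dist: "(d j)\<^sup>2 \<le> (a / b) ^ j * (d 0)\<^sup>2" if "j \<le> k" for j
    using that
  proof (induction j)
    case (Suc j)
    have "0 \<le> 2 * \<rho> * v (Suc j)" using v \<open>0 < \<rho>\<close> by simp
    then have "b * (d (Suc j))\<^sup>2 \<le> a * (d j)\<^sup>2" using step[of j] Suc.prems by linarith
    then have "(d (Suc j))\<^sup>2 \<le> a / b * (d j)\<^sup>2" using \<open>0 < b\<close> by (simp add: field_simps)
    also have "\<dots> \<le> a / b * ((a / b) ^ j * (d 0)\<^sup>2)"
      using Suc \<open>0 \<le> a\<close> \<open>0 < b\<close> by (intro mult_left_mono) auto
    finally show ?case by simp
  qed simp
  then show "(d k)\<^sup>2 \<le> (a / b) ^ k * (d 0)\<^sup>2" by simp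
  assume "1 \<le> k"
  then obtain j where k: "k = Suc j" by (cases k) auto
  have "0 \<le> b * (d k)\<^sup>2" using \<open>0 < b\<close> by simp
  \<comment> \<open>The gap at \<open>k\<close> is controlled by the distance one step earlier,
    hence the need for \<open>1 \<le> k\<close>.\<close>
  then have "2 * \<rho> * v k \<le> a * (d j)\<^sup>2" using step[of j] k by simp
  also have "\<dots> \<le> a * ((a / b) ^ j * (d 0)\<^sup>2)"
    using dist[of j] k \<open>0 \<le> a\<close> by (intro mult_left_mono) auto
  \<comment> \<open>Writing \<open>a\<close> as \<open>b * (a / b)\<close> raises the exponent from
    \<open>j\<close> to \<open>k\<close> and leaves the prefactor \<open>b\<close>.\<close>
  also have "\<dots> = b * (a / b) ^ k * (d 0)\<^sup>2" using \<open>0 < b\<close> by (simp add: k)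
  finally have "v k \<le> b * (a / b) ^ k * (d 0)\<^sup>2 / (2 * \<rho>)"
    using \<open>0 < \<rho>\<close> by (subst pos_le_divide_eq) (simp_all add: mult.commute)
  then show "v k \<le> b / (2 * \<rho>) * (a / b) ^ k * (d 0)\<^sup>2" by simp
qed

theorem theorem2:
  fixes p' q' p q :: nat
    and \<Q> :: "(real ^ 'n ^ 'n) set"
    and c_min c_max l_min l_max u_min u_max :: "real ^ 'n"
    and \<P> :: "'n qp set"
    and L \<sigma> \<rho> \<Omega> \<epsilon> :: real
    and X0 :: "'n qp \<Rightarrow> (real ^ 'n) set"
    and g_hat :: "'n qp \<Rightarrow> real ^ 'n \<Rightarrow> real ^ 'n"
    and P :: "'n qp"
    and x0 :: "real ^ 'n"
    and x_hat :: "nat \<Rightarrow> real ^ 'n"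
  assumes "compact \<Q>" and "\<Q> \<subseteq> fixed_mats p' q'"
    and "{c_min, c_max, l_min, l_max, u_min, u_max} \<subseteq> fixed_vecs p' q'"
    and family: "\<P> = qp_family p' q' \<Q> c_min c_max l_min l_max u_min u_max"
    and "0 < L" and "0 < \<sigma>"
    and smooth: "\<And>R x y. R \<in> \<P> \<Longrightarrow>
      qp_obj R x \<le> qp_obj R y + gradient (qp_obj R) y \<bullet> (x - y) + L / 2 * (norm (x - y))\<^sup>2"
    and strongly_convex: "\<And>R x y. R \<in> \<P> \<Longrightarrow>
      qp_obj R x \<ge> qp_obj R y + gradient (qp_obj R) y \<bullet> (x - y) + \<sigma> / 2 * (norm (x - y))\<^sup>2"
    and "p' \<le> p" and "q' \<le> q"
    and "\<rho> \<in> fixed_nums p q" and "0 < \<rho>" and "\<rho> \<le> inverse L"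
    and X0: "\<And>R. R \<in> \<P> \<Longrightarrow> X0 R \<subseteq> qp_feasible R \<inter> fixed_vecs p q"
    and g_hat: "\<And>R. R \<in> \<P> \<Longrightarrow> g_hat R \<in> qp_feasible R \<inter> fixed_vecs p q \<rightarrow> fixed_vecs p q"
    and "0 < \<Omega>"
    and error_bound: "\<And>R x. R \<in> \<P> \<Longrightarrow> x \<in> qp_feasible R \<inter> fixed_vecs p q \<Longrightarrow>
      norm (\<rho> *\<^sub>R gradient (qp_obj R) x - g_hat R x) \<le> \<Omega>"
    and "P \<in> \<P>"
    and "x0 \<in> X0 P"
    and iterates: "x_hat = prox_grad P (g_hat P) x0"
    and no_overflow: "\<And>k. x_hat k - g_hat P (x_hat k) \<in> fixed_vecs p q"
    and "0 < \<epsilon>" and "4 * \<Omega> < \<epsilon> * \<rho> * \<sigma>"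
  shows "\<forall>k. (\<forall>j<k. \<epsilon> / 2 \<le> norm (x_hat (j + 1) - qp_sol P)) \<longrightarrow>
    (norm (x_hat k - qp_sol P))\<^sup>2
      \<le> ((1 - \<rho> * \<sigma>) / (1 - 4 * \<Omega> * inverse \<epsilon>)) ^ k * (norm (x_hat 0 - qp_sol P))\<^sup>2 \<and>
    (1 \<le> k \<longrightarrow>
      qp_obj P (x_hat k) - qp_val P
        \<le> (1 - 4 * \<Omega> * inverse \<epsilon>) / (2 * \<rho>)
            * ((1 - \<rho> * \<sigma>) / (1 - 4 * \<Omega> * inverse \<epsilon>)) ^ k * (norm (x_hat 0 - qp_sol P))\<^sup>2)"
proof (intro allI impI)
  fix k assume far: "\<forall>j<k. \<epsilon> / 2 \<le> norm (x_hat (j + 1) - qp_sol P)"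
  have P: "lower P \<le> upper P" "lower P \<in> fixed_vecs p q" "upper P \<in> fixed_vecs p q"
    using \<open>P \<in> \<P>\<close> fixed_vecs_mono[OF \<open>p' \<le> p\<close> \<open>q' \<le> q\<close>] unfolding family qp_family_def by auto
  \<comment> \<open>Membership in both sets is what \<open>error_bound\<close> requires at each
    iterate; feasibility also yields nonnegative gaps.\<close>
  have feas: "x_hat j \<in> qp_feasible P \<inter> fixed_vecs p q" for j
  proof (cases j)
    case 0
    then show ?thesis using X0[OF \<open>P \<in> \<P>\<close>] \<open>x0 \<in> X0 P\<close> iterates by auto
  next
    case (Suc i)
    then show ?thesis
      using clamp_in_box[OF P(1), of "x_hat i - g_hat P (x_hat i)"]
        clamp_in_fixed_vecs[OF P(2,3) no_overflow[of i]]
      by (simp add: iterates qp_feasible_def)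
  qed
  have sol: "is_arg_min (qp_obj P) (\<lambda>y. y \<in> qp_feasible P) (qp_sol P)"
    using strongly_convex[OF \<open>P \<in> \<P>\<close>] \<open>0 < \<sigma>\<close> P(1) by (rule qp_sol_is_arg_min)
  have "\<sigma> \<le> L"
    using smooth[OF \<open>P \<in> \<P>\<close>] strongly_convex[OF \<open>P \<in> \<P>\<close>] by (rule strong_convexity_le_smoothness)
  have \<rho>L: "\<rho> * L \<le> 1" using \<open>\<rho> \<le> inverse L\<close> \<open>0 < L\<close> by (simp add: field_simps)
  then have \<rho>\<sigma>: "\<rho> * \<sigma> \<le> 1" using \<open>\<sigma> \<le> L\<close> \<open>0 < \<rho>\<close> by (meson mult_left_mono less_imp_le order_trans)
  \<comment> \<open>Together with \<open>\<rho> * \<sigma> \<le> 1\<close> this makes the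
    denominator of the rate positive.\<close>
  have "4 * \<Omega> * inverse \<epsilon> < \<rho> * \<sigma>"
    using \<open>4 * \<Omega> < \<epsilon> * \<rho> * \<sigma>\<close> \<open>0 < \<epsilon>\<close> by (simp add: field_simps)
  then have b: "0 < 1 - 4 * \<Omega> * inverse \<epsilon>" using \<rho>\<sigma> by linarith
  define d where "d j = norm (x_hat j - qp_sol P)" for j
  define v where "v j = qp_obj P (x_hat j) - qp_val P" for j
  have step: "2 * \<rho> * v (Suc j) + (1 - 4 * \<Omega> * inverse \<epsilon>) * (d (Suc j))\<^sup>2
      \<le> (1 - \<rho> * \<sigma>) * (d j)\<^sup>2" if "j < k" for j
  proof -
    have "qp_sol P \<in> {lower P..upper P}" using sol by (simp add: is_arg_min_def qp_feasible_def)
    from clamp_inner_le_0[OF this, of "x_hat j - g_hat P (x_hat j)"]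
    have "(x_hat j - g_hat P (x_hat j) - x_hat (Suc j)) \<bullet> (qp_sol P - x_hat (Suc j)) \<le> 0"
      by (simp add: iterates)
    from inexact_prox_grad_step[where f = "qp_obj P", OF smooth[OF \<open>P \<in> \<P>\<close>]
        strongly_convex[OF \<open>P \<in> \<P>\<close>] this error_bound[OF \<open>P \<in> \<P>\<close> feas] \<open>0 < \<rho>\<close> \<rho>L]
    have *: "2 * \<rho> * v (Suc j) + (d (Suc j))\<^sup>2 \<le> (1 - \<rho> * \<sigma>) * (d j)\<^sup>2 + 2 * \<Omega> * d (Suc j)"
      by (simp add: d_def v_def qp_val_def)
    have "\<epsilon> / 2 \<le> d (Suc j)" using far that by (simp add: d_def)
    \<comment> \<open>Multiplying the linear error term by this quantity, which is at least 1, makes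
      it quadratic in \<open>d (Suc j)\<close>.\<close>
    then have "1 \<le> 2 * inverse \<epsilon> * d (Suc j)" using \<open>0 < \<epsilon>\<close> by (simp add: field_simps)
    then have "2 * \<Omega> * d (Suc j) * 1 \<le> 2 * \<Omega> * d (Suc j) * (2 * inverse \<epsilon> * d (Suc j))"
      using \<open>0 < \<Omega>\<close> by (intro mult_left_mono) (auto simp: d_def)
    then have "2 * \<Omega> * d (Suc j) \<le> 4 * \<Omega> * inverse \<epsilon> * (d (Suc j))\<^sup>2"
      by (simp add: power2_eq_square algebra_simps)
    then show ?thesis using * unfolding left_diff_distrib by linarith
  qed
  have "0 \<le> v j" for j
    using sol feas[of j] by (simp add: v_def qp_val_def is_arg_min_linorder)
  \<comment> \<open>The premise left open is \<open>0 \<le> 1 - \<rho> * \<sigma>\<close>, supplied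
    at the end by \<open>\<rho>\<sigma>\<close>.\<close>
  note bounds = recurrence_bounds[where d = d and v = v, OF step this _ b \<open>0 < \<rho>\<close>]
  show "(norm (x_hat k - qp_sol P))\<^sup>2
      \<le> ((1 - \<rho> * \<sigma>) / (1 - 4 * \<Omega> * inverse \<epsilon>)) ^ k * (norm (x_hat 0 - qp_sol P))\<^sup>2 \<and>
    (1 \<le> k \<longrightarrow>
      qp_obj P (x_hat k) - qp_val P
        \<le> (1 - 4 * \<Omega> * inverse \<epsilon>) / (2 * \<rho>)
            * ((1 - \<rho> * \<sigma>) / (1 - 4 * \<Omega> * inverse \<epsilon>)) ^ k * (norm (x_hat 0 - qp_sol P))\<^sup>2)"
    using bounds[of k, unfolded d_def v_def] \<rho>\<sigma> by simp
qed

end
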